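(* Let $k,s$ be positive integers. There exists an integer $n_0(k,s)$ such that for all $n\ge n_0(k,s)$ and every family $\mathcal{F}\subset\binom{[n]}{k}$ with $\nu(\mathcal{F})\le s$, $$\mathrm{co}_2(\mathcal{F})\le\mathrm{co}_2(\mathcal{B}(n,k,s)),$$ with equality if and only if $\mathcal{F}\cong\mathcal{B}(n,k,s)$.
   Context: $[n]=\{1,\dots,n\}$ and $\binom{[n]}{k}$ is the family of $k$-element subsets of $[n]$. The matching number $\nu(\mathcal{F})$ is the maximum number of pairwise disjoint sets in $\mathcal{F}$. $\mathcal{B}(n,k,s)=\{F\in\binom{[n]}{k}:F\cap[s]\neq\emptyset\}$. For $\mathcal{F}\subset\binom{[n]}{k}$ and $E\subseteq[n]$, $d(E)$ is the number of members of $\mathcal{F}$ containing $E$, and $\mathrm{co}_2(\mathcal{F})=\sum_{E\in\binom{[n]}{k-1}}d(E)^2$. The symbol $\cong$ denotes equality up to a permutation of $[n]$. *)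

theory Defs
  imports "HOL-Library.Ramsey" "HOL-Library.Disjoint_Sets" "HOL-Combinatorics.Permutations"
begin

text \<open>
  The ground set $[n]$ is \<open>{1..n}\<close>, and the family of its \<open>k\<close>-element subsets is
  \<open>nsets {1..n} k\<close>.
\<close>

text \<open>Intended for finite families, where the maximum is taken over a finite nonempty set
  (the empty subfamily always qualifies).\<close>

definition matching_number :: "'a set set \<Rightarrow> nat" where
  "matching_number \<F> = Max {card M | M. M \<subseteq> \<F> \<and> disjoint M}"

definition hitting_family :: "nat \<Rightarrow> nat \<Rightarrow> nat \<Rightarrow> nat set set" where
  "hitting_family n k s = {F \<in> nsets {1..n} k. F \<inter> {1..s} \<noteq> {}}"

definition set_degree :: "'a set set \<Rightarrow> 'a set \<Rightarrow> nat" where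
  "set_degree \<F> E = card {F \<in> \<F>. E \<subseteq> F}"

text \<open>The parameters \<open>n\<close> and \<open>k\<close> are explicit because they cannot be recovered from the family;
  subtraction is on naturals, so this is meant for \<open>k > 0\<close>.\<close>

definition co2 :: "nat \<Rightarrow> nat \<Rightarrow> nat set set \<Rightarrow> nat" where
  "co2 n k \<F> = (\<Sum>E \<in> nsets {1..n} (k - 1). (set_degree \<F> E)\<^sup>2)"

definition family_iso :: "nat \<Rightarrow> nat set set \<Rightarrow> nat set set \<Rightarrow> bool" where
  "family_iso n \<F> \<G> \<longleftrightarrow> (\<exists>\<pi>. \<pi> permutes {1..n} \<and> (image \<pi>) ` \<F> = \<G>)"

end

theory Submission
  imports Defs Complex_Main
begin

text \<open>
  For large \<open>n\<close> the value of \<open>co2\<close> is governed by the vertices contained in many members of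
  \<open>\<F>\<close>. Let \<open>k \<ge> 2\<close> and let \<open>T\<close> be the set of vertices of degree greater than
  \<open>k * (s + 1) * n ^ (k - 2)\<close>. Two vertices lie together in at most \<open>n ^ (k - 2)\<close> sets of size
  \<open>k\<close>, so through a vertex of \<open>T\<close> there is always a member of \<open>\<F>\<close> that avoids any prescribed
  \<open>k * (s + 1)\<close> other vertices. Choosing such members greedily, one for each vertex of \<open>T\<close>,
  gives a matching (\<open>matching_through_high_degree\<close>). Hence \<open>card T \<le> s\<close>, and if \<open>card T = s\<close>, a
  member of \<open>\<F>\<close> disjoint from \<open>T\<close> could be added to a matching of size \<open>s\<close>; so every member
  meets \<open>T\<close> (\<open>high_degree_structure\<close>). In that case \<open>\<F>\<close> lies inside a copy of the hitting
  family, and since \<open>co2\<close> is strictly monotone under inclusion, both the inequality and the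
  characterization of equality follow (\<open>meeting_family_extremal\<close>).

  If \<open>card T < s\<close>, the inequality is strict. The members of a maximum matching cover at most
  \<open>k * s\<close> vertices and every member of \<open>\<F>\<close> meets that cover, so the members disjoint from \<open>T\<close>
  all pass through one of boundedly many vertices of low degree, and there are only
  \<open>O(n ^ (k - 2))\<close> of them. The sets \<open>E\<close> disjoint from \<open>T\<close> therefore contribute only
  \<open>O(n ^ (k - 1))\<close> to \<open>co2\<close> (\<open>co2_le_few_high_degree\<close>), while every set \<open>E\<close> meeting \<open>T\<close> contributes
  at most \<open>(n - k + 1)\<^sup>2\<close>. The family of all \<open>k\<close>-sets meeting \<open>T\<close> or one further vertex \<open>x\<close>
  attains \<open>(n - k + 1)\<^sup>2\<close> on all those \<open>E\<close> and also on every \<open>E\<close> that contains \<open>x\<close> but misses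
  \<open>T\<close>; the latter give an extra term of order \<open>n ^ k\<close>
  (\<open>co2_meeting_family_insert_ge\<close>), which wins for large \<open>n\<close>. This family is contained in a copy
  of the hitting family.

  For \<open>k = 1\<close> the members of \<open>\<F>\<close> are singletons and form a matching themselves, so \<open>\<Union>\<F>\<close> takes the
  role of \<open>T\<close>.
\<close>

section \<open>Counting sets of fixed size\<close>

lemma card_nsets_choose: "finite V \<Longrightarrow> card (nsets V k) = card V choose k"
proof -
  assume "finite V"
  then have "nsets V k = {F. F \<subseteq> V \<and> card F = k}"
    by (auto simp: nsets_def intro: finite_subset)
  then show ?thesis using \<open>finite V\<close> by (simp add: n_subsets)
qed

lemma choose_le_power: "n choose k \<le> n ^ k" for n k :: nat
  using binomial_le_pow[of k n] by (cases "k \<le> n") (simp_all add: binomial_eq_0)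

lemma power_le_choose: "n ^ k \<le> k ^ k * (n choose k)" if "k \<le> n" for n k :: nat
proof (cases "k = 0")
  case False
  have "(real n / real k) ^ k \<le> real (n choose k)"
    by (rule binomial_ge_n_over_k_pow_k) (use that in simp)
  then have "real (n ^ k) \<le> real (k ^ k * (n choose k))"
    using False by (simp add: power_divide divide_simps mult.commute)
  then show ?thesis by (simp only: of_nat_le_iff)
qed simp

lemma card_pair_star_le:
  assumes "finite V" and "\<F> \<subseteq> nsets V k" and "x \<noteq> y"
  shows "card {F \<in> \<F>. x \<in> F \<and> y \<in> F} \<le> card V ^ (k - 2)"
proof -
  let ?S = "{F \<in> \<F>. x \<in> F \<and> y \<in> F}"
  have "inj_on (\<lambda>F. F - {x, y}) ?S" by (auto simp: inj_on_def)
  moreover have "(\<lambda>F. F - {x, y}) ` ?S \<subseteq> nsets V (k - 2)"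
    using assms by (auto simp: nsets_def card_Diff_subset)
  ultimately have "card ?S \<le> card (nsets V (k - 2))"
    using assms(1) by (intro card_inj_on_le finite_imp_finite_nsets)
  also have "\<dots> \<le> card V ^ (k - 2)"
    using assms(1) by (simp add: card_nsets_choose choose_le_power)
  finally show ?thesis .
qed

text \<open>A set of size \<open>k\<close> above a set \<open>E\<close> of size \<open>k - 1\<close> is \<open>E\<close> plus one point, so the degree
  of \<open>E\<close> counts the possible extra points.\<close>

lemma nsets_superset_is_insert:
  assumes "E \<in> nsets V (k - 1)" and "F \<in> nsets V k" and "E \<subseteq> F" and "k > 0"
  shows "F \<in> (\<lambda>x. insert x E) ` (V - E)"
proof -
  have fin: "finite E" "finite F" and cards: "card E = k - 1" "card F = k" and "F \<subseteq> V"
    using assms by (auto simp: nsets_def)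
  have "card (F - E) = 1"
    using fin cards assms by (simp add: card_Diff_subset)
  then obtain x where "F - E = {x}" by (auto simp: card_1_singleton_iff)
  then have "F = insert x E" "x \<in> V - E" using assms(3) \<open>F \<subseteq> V\<close> by auto
  then show ?thesis by (rule image_eqI)
qed

lemma insert_in_nsets:
  assumes "E \<in> nsets V (k - 1)" and "x \<in> V - E" and "k > 0"
  shows "insert x E \<in> nsets V k"
  using assms by (auto simp: nsets_def)

lemma card_insert_image: "A \<inter> E = {} \<Longrightarrow> card ((\<lambda>x. insert x E) ` A) = card A"
  by (rule card_image) (auto simp: inj_on_def)

lemma set_degree_le:
  assumes "finite V" and "\<F> \<subseteq> nsets V k" and "k > 0" and "E \<in> nsets V (k - 1)"
  shows "set_degree \<F> E \<le> card V - (k - 1)"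
proof -
  have "{F \<in> \<F>. E \<subseteq> F} \<subseteq> (\<lambda>x. insert x E) ` (V - E)"
    using nsets_superset_is_insert[OF assms(4) _ _ assms(3)] assms(2) by (simp add: subset_iff)
  then have "set_degree \<F> E \<le> card ((\<lambda>x. insert x E) ` (V - E))"
    unfolding set_degree_def using assms(1) by (intro card_mono) auto
  also have "\<dots> = card V - (k - 1)"
    using assms(1,4) by (subst card_insert_image) (auto simp: nsets_def card_Diff_subset)
  finally show ?thesis .
qed

text \<open>Double counting of the pairs \<open>E \<subseteq> F\<close>: each member \<open>F\<close> has at most \<open>k\<close> subsets of size
  \<open>k - 1\<close>. The factor \<open>k + 1\<close> instead of \<open>k\<close> covers \<open>k = 0\<close>, where \<open>k - 1\<close> truncates to \<open>0\<close> and
  the empty set is one such subset.\<close>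

lemma sum_set_degree:
  assumes "finite V" and "\<F> \<subseteq> nsets V k"
  shows "(\<Sum>E \<in> nsets V (k - 1). set_degree \<F> E) \<le> (k + 1) * card \<F>"
proof -
  have fin: "finite \<F>" using assms finite_imp_finite_nsets finite_subset by metis
  have "(\<Sum>E \<in> nsets V (k - 1). set_degree \<F> E)
      = (\<Sum>E \<in> nsets V (k - 1). \<Sum>F \<in> \<F>. if E \<subseteq> F then 1 else 0)"
    unfolding set_degree_def using fin by (simp add: sum.If_cases Int_def)
  also have "\<dots> = (\<Sum>F \<in> \<F>. \<Sum>E \<in> nsets V (k - 1). if E \<subseteq> F then 1 else 0)"
    by (rule sum.swap)
  also have "\<dots> \<le> (\<Sum>F \<in> \<F>. k + 1)"
  proof (rule sum_mono)
    fix F assume "F \<in> \<F>"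
    then have F: "finite F" "card F = k" "F \<subseteq> V" using assms by (auto simp: nsets_def)
    have "(\<Sum>E \<in> nsets V (k - 1). if E \<subseteq> F then 1 else 0) = card {E \<in> nsets V (k - 1). E \<subseteq> F}"
      using assms(1) by (simp add: sum.If_cases Int_def finite_imp_finite_nsets)
    also have "{E \<in> nsets V (k - 1). E \<subseteq> F} = nsets F (k - 1)"
      using F(3) by (auto simp: nsets_def)
    also have "card \<dots> = k choose (k - 1)" using F by (simp add: card_nsets_choose)
    also have "\<dots> \<le> k + 1" by (cases k) auto
    finally show "(\<Sum>E \<in> nsets V (k - 1). if E \<subseteq> F then 1 else 0) \<le> k + 1" .
  qed
  finally show ?thesis by (simp add: mult.commute)
qed

section \<open>Families meeting a fixed set\<close>

definition meeting_family :: "nat \<Rightarrow> nat \<Rightarrow> nat set \<Rightarrow> nat set set" where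
  "meeting_family n k T = {F \<in> nsets {1..n} k. F \<inter> T \<noteq> {}}"

lemma finite_meeting_family: "finite (meeting_family n k T)"
  by (simp add: meeting_family_def finite_imp_finite_nsets)

lemma set_degree_permute:
  assumes "bij \<pi>"
  shows "set_degree ((image \<pi>) ` \<F>) (\<pi> ` E) = set_degree \<F> E"
proof -
  have inj: "inj \<pi>" using assms by (rule bij_is_inj)
  have "{F \<in> (image \<pi>) ` \<F>. \<pi> ` E \<subseteq> F} = (image \<pi>) ` {F \<in> \<F>. E \<subseteq> F}"
    using inj by (auto simp: inj_image_subset_iff)
  moreover have "inj_on (image \<pi>) {F \<in> \<F>. E \<subseteq> F}"
    using inj by (auto simp: inj_on_def inj_image_eq_iff)
  ultimately show ?thesis by (simp add: set_degree_def card_image)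
qed

lemma bij_betw_image_nsets:
  assumes "\<pi> permutes V"
  shows "bij_betw (image \<pi>) (nsets V k) (nsets V k)"
proof -
  have inj: "inj \<pi>" using assms by (rule permutes_inj)
  have sub: "image p ` nsets V k \<subseteq> nsets V k" if "p permutes V" for p
  proof -
    have "card (p ` F) = card F" for F
      using permutes_inj[OF that] by (simp add: card_image inj_on_subset)
    moreover have "p ` F \<subseteq> V" if "F \<subseteq> V" for F
      using permutes_image[OF \<open>p permutes V\<close>] that by blast
    ultimately show ?thesis by (auto simp: nsets_def)
  qed
  have "nsets V k \<subseteq> image \<pi> ` nsets V k"
  proof
    fix F assume "F \<in> nsets V k"
    then have "inv \<pi> ` F \<in> nsets V k" using sub[OF permutes_inv[OF assms]] by blast
    moreover have "\<pi> ` inv \<pi> ` F = F"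
      using permutes_surj[OF assms] by (simp add: image_f_inv_f)
    ultimately show "F \<in> image \<pi> ` nsets V k" by (metis imageI)
  qed
  then show ?thesis
    using sub[OF assms] inj by (auto simp: bij_betw_def inj_on_def inj_image_eq_iff)
qed

lemma co2_family_iso:
  assumes "family_iso n \<F> \<G>"
  shows "co2 n k \<F> = co2 n k \<G>"
proof -
  obtain \<pi> where \<pi>: "\<pi> permutes {1..n}" "(image \<pi>) ` \<F> = \<G>"
    using assms by (auto simp: family_iso_def)
  have "co2 n k \<G> = (\<Sum>E \<in> nsets {1..n} (k - 1). (set_degree \<G> (\<pi> ` E))\<^sup>2)"
    unfolding co2_def using bij_betw_image_nsets[OF \<pi>(1)]
    by (rule sum.reindex_bij_betw[symmetric])
  then show ?thesis
    unfolding co2_def \<pi>(2)[symmetric] set_degree_permute[OF permutes_bij[OF \<pi>(1)]] by simp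
qed

text \<open>A bijection of \<open>T\<close> onto \<open>{1..s}\<close> and one of the complements glue to a permutation of
  \<open>{1..n}\<close>.\<close>

lemma meeting_family_iso:
  assumes "T \<subseteq> {1..n}" and "card T = s" and "s \<le> n"
  shows "family_iso n (meeting_family n k T) (hitting_family n k s)"
proof -
  have fin: "finite T" using assms finite_subset by blast
  obtain f where f: "bij_betw f T {1..s}"
    using fin assms(2) by (metis finite_same_card_bij card_atLeastAtMost diff_Suc_1 finite_atLeastAtMost)
  have "card ({1..n} - T) = card ({1..n} - {1..s})"
    using fin assms by (simp add: card_Diff_subset)
  then obtain g where g: "bij_betw g ({1..n} - T) ({1..n} - {1..s})"
    by (metis finite_same_card_bij finite_Diff finite_atLeastAtMost)
  define \<pi> where "\<pi> x = (if x \<in> T then f x else if x \<in> {1..n} then g x else x)" for x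
  have \<pi>T: "bij_betw \<pi> T {1..s}"
    using f by (rule bij_betw_cong[THEN iffD1, rotated]) (simp add: \<pi>_def)
  have \<pi>D: "bij_betw \<pi> ({1..n} - T) ({1..n} - {1..s})"
    using g by (rule bij_betw_cong[THEN iffD1, rotated]) (simp add: \<pi>_def)
  have "bij_betw \<pi> (T \<union> ({1..n} - T)) ({1..s} \<union> ({1..n} - {1..s}))"
    using \<pi>T \<pi>D by (rule bij_betw_combine) auto
  moreover have "T \<union> ({1..n} - T) = {1..n}" "{1..s} \<union> ({1..n} - {1..s}) = {1..n}"
    using assms by auto
  ultimately have "bij_betw \<pi> {1..n} {1..n}" by simp
  then have perm: "\<pi> permutes {1..n}"
    by (rule bij_imp_permutes) (use assms(1) in \<open>auto simp: \<pi>_def\<close>)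
  have inj: "inj \<pi>" using perm by (rule permutes_inj)
  have img: "\<pi> ` T = {1..s}" using \<pi>T by (simp add: bij_betw_def)
  have meets: "\<pi> ` F \<inter> {1..s} \<noteq> {} \<longleftrightarrow> F \<inter> T \<noteq> {}" for F
    unfolding img[symmetric] image_Int[OF inj, symmetric] by simp
  have onto: "(image \<pi>) ` nsets {1..n} k = nsets {1..n} k"
    using bij_betw_image_nsets[OF perm] by (simp add: bij_betw_def)
  have "(image \<pi>) ` meeting_family n k T
      = (image \<pi>) ` {F \<in> nsets {1..n} k. \<pi> ` F \<inter> {1..s} \<noteq> {}}"
    by (simp only: meeting_family_def meets)
  also have "\<dots> = {G \<in> (image \<pi>) ` nsets {1..n} k. G \<inter> {1..s} \<noteq> {}}"
    by (auto simp del: One_nat_def)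
  finally have "(image \<pi>) ` meeting_family n k T = hitting_family n k s"
    by (simp only: onto hitting_family_def)
  then show ?thesis using perm by (auto simp: family_iso_def)
qed

lemma set_degree_mono: "\<F> \<subseteq> \<G> \<Longrightarrow> finite \<G> \<Longrightarrow> set_degree \<F> E \<le> set_degree \<G> E"
  unfolding set_degree_def by (intro card_mono) auto

lemma co2_mono: "\<F> \<subseteq> \<G> \<Longrightarrow> finite \<G> \<Longrightarrow> co2 n k \<F> \<le> co2 n k \<G>"
  unfolding co2_def by (intro sum_mono power_mono set_degree_mono) auto

text \<open>A member \<open>A\<close> of \<open>\<G>\<close> outside \<open>\<F>\<close> raises the degree of each \<open>E \<subseteq> A\<close> of size \<open>k - 1\<close>.\<close>

lemma co2_strict_mono:
  assumes "\<F> \<subset> \<G>" and "\<G> \<subseteq> nsets {1..n} k"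
  shows "co2 n k \<F> < co2 n k \<G>"
proof -
  have finG: "finite \<G>" using assms(2) finite_imp_finite_nsets finite_subset by blast
  obtain A where A: "A \<in> \<G>" "A \<notin> \<F>" using assms(1) by blast
  then have "A \<subseteq> {1..n}" "finite A" "card A = k" using assms(2) by (auto simp: nsets_def)
  moreover obtain E where "E \<subseteq> A" "card E = k - 1" "finite E"
    using obtain_subset_with_card_n[of "k - 1" A] \<open>card A = k\<close> by auto
  ultimately have E: "E \<in> nsets {1..n} (k - 1)" "E \<subseteq> A" by (auto simp: nsets_def)
  have "{F \<in> \<F>. E \<subseteq> F} \<subset> {F \<in> \<G>. E \<subseteq> F}" using assms(1) A E(2) by blast
  then have "set_degree \<F> E < set_degree \<G> E"
    unfolding set_degree_def using finG by (intro psubset_card_mono) auto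
  then have "(set_degree \<F> E)\<^sup>2 < (set_degree \<G> E)\<^sup>2" by (intro power_strict_mono) auto
  then show ?thesis
    unfolding co2_def using assms(1) finG E(1)
    by (intro sum_strict_mono_ex1)
       (auto intro!: finite_imp_finite_nsets power_mono set_degree_mono)
qed

text \<open>Enlarging \<open>T\<close> to exactly \<open>s\<close> vertices puts \<open>\<F>\<close> inside a copy of the hitting family. If the
  inclusion is proper, strict monotonicity rules out equality of \<open>co2\<close>, and then also an
  isomorphism, because isomorphic families have the same \<open>co2\<close>.\<close>

lemma meeting_family_extremal:
  assumes "\<F> \<subseteq> meeting_family n k T" and "T \<subseteq> {1..n}" and "card T \<le> s" and "s \<le> n"
  shows "co2 n k \<F> \<le> co2 n k (hitting_family n k s) \<and>
    (co2 n k \<F> = co2 n k (hitting_family n k s) \<longleftrightarrow> family_iso n \<F> (hitting_family n k s))"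
proof -
  obtain T' where T': "T \<subseteq> T'" "T' \<subseteq> {1..n}" "card T' = s"
    using exists_subset_between[OF assms(3) _ assms(2)] assms(4) by auto
  let ?B = "meeting_family n k T'"
  have sub: "\<F> \<subseteq> ?B" using assms(1) T'(1) by (auto simp: meeting_family_def)
  have iso: "family_iso n ?B (hitting_family n k s)"
    using meeting_family_iso T' assms(4) by blast
  have eq: "co2 n k ?B = co2 n k (hitting_family n k s)" using co2_family_iso[OF iso] .
  have strict: "co2 n k \<F> < co2 n k ?B" if "\<F> \<noteq> ?B"
    using sub that by (intro co2_strict_mono) (auto simp: meeting_family_def)
  show ?thesis
    using strict eq iso co2_family_iso[of n \<F> "hitting_family n k s" k]
      co2_mono[OF sub finite_meeting_family, of n k] by fastforce
qed

section \<open>Matchings through vertices of high degree\<close>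

lemma card_le_matching_number:
  assumes "finite \<F>" and "M \<subseteq> \<F>" and "disjoint M"
  shows "card M \<le> matching_number \<F>"
proof -
  have "{card M | M. M \<subseteq> \<F> \<and> disjoint M} \<subseteq> card ` Pow \<F>" by auto
  then have "finite {card M | M. M \<subseteq> \<F> \<and> disjoint M}"
    using assms(1) by (meson finite_Pow_iff finite_imageI finite_subset)
  then show ?thesis unfolding matching_number_def using assms by (intro Max_ge) auto
qed

text \<open>The members that contain \<open>x\<close> and meet \<open>W\<close> are covered by the pair stars of \<open>x\<close> and \<open>y \<in> W\<close>,
  and each of these has at most \<open>card V ^ (k - 2)\<close> members.\<close>

lemma high_degree_avoids:
  assumes "finite V" and "\<F> \<subseteq> nsets V k" and "finite W" and "x \<notin> W" and "card W \<le> L"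
    and "card {F \<in> \<F>. x \<in> F} > L * card V ^ (k - 2)"
  obtains F where "F \<in> \<F>" and "x \<in> F" and "F \<inter> W = {}"
proof -
  have fin: "finite \<F>" using assms finite_imp_finite_nsets finite_subset by metis
  have "\<not> {F \<in> \<F>. x \<in> F} \<subseteq> (\<Union>y\<in>W. {F \<in> \<F>. x \<in> F \<and> y \<in> F})"
  proof
    assume "{F \<in> \<F>. x \<in> F} \<subseteq> (\<Union>y\<in>W. {F \<in> \<F>. x \<in> F \<and> y \<in> F})"
    then have "card {F \<in> \<F>. x \<in> F} \<le> card (\<Union>y\<in>W. {F \<in> \<F>. x \<in> F \<and> y \<in> F})"
      using fin assms(3) by (intro card_mono) auto
    also have "\<dots> \<le> (\<Sum>y\<in>W. card {F \<in> \<F>. x \<in> F \<and> y \<in> F})"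
      using assms(3) by (rule card_UN_le)
    also have "\<dots> \<le> (\<Sum>y\<in>W. card V ^ (k - 2))"
      using assms(1,2,4) by (intro sum_mono card_pair_star_le) auto
    also have "\<dots> \<le> L * card V ^ (k - 2)" using assms(5) by simp
    finally show False using assms(6) by simp
  qed
  then show thesis using that by blast
qed

text \<open>Greedy choice: the member picked through \<open>x\<close> avoids \<open>W\<close> and the vertices of \<open>T\<close> still to be
  treated, and is then added to the set \<open>W\<close> that later members have to avoid. Each step adds \<open>k\<close>
  vertices to \<open>W\<close> and removes one from \<open>T\<close>, so \<open>card W + k * card T\<close> does not grow.\<close>

lemma matching_through_high_degree:
  assumes V: "finite V" "\<F> \<subseteq> nsets V k" "k > 0"
    and "finite T" and "finite W" and "T \<inter> W = {}" and "card W + k * card T \<le> L"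
    and "\<forall>x\<in>T. card {F \<in> \<F>. x \<in> F} > L * card V ^ (k - 2)"
  shows "\<exists>M \<subseteq> \<F>. disjoint M \<and> card M = card T \<and> finite M \<and> \<Union>M \<inter> W = {}"
  using assms(4-8)
proof (induction T arbitrary: W rule: finite_induct)
  case empty
  then show ?case by (intro exI[of _ "{}"]) simp
next
  case (insert x T)
  have "1 * card T \<le> k * card T" using V(3) by (intro mult_right_mono) auto
  moreover have "card W + (k + k * card T) \<le> L" using insert.prems(3) insert.hyps by simp
  ultimately have "card (W \<union> T) \<le> L"
    using card_Un_le[of W T] by linarith
  then obtain F where F: "F \<in> \<F>" "x \<in> F" "F \<inter> (W \<union> T) = {}"
    using high_degree_avoids[OF V(1,2), of "W \<union> T" x L] insert by auto
  then have kF: "finite F" "card F = k" using V(2) by (auto simp: nsets_def)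
  have "card (W \<union> F) + k * card T \<le> L"
    using card_Un_le[of W F] kF(2) \<open>card W + (k + k * card T) \<le> L\<close> by linarith
  moreover have "T \<inter> (W \<union> F) = {}" using insert.prems(2) F(3) by blast
  ultimately obtain M where M: "M \<subseteq> \<F>" "disjoint M" "card M = card T" "finite M"
      "\<Union>M \<inter> (W \<union> F) = {}"
    using insert.IH[of "W \<union> F"] insert.prems kF by auto
  have "F \<notin> M" using M(5) F(2) by blast
  moreover have "disjoint (insert F M)"
    using M(2,5) by (auto simp: pairwise_insert disjnt_def)
  moreover have "\<Union>(insert F M) \<inter> W = {}" using M(5) F(3) by blast
  ultimately show ?case
    using M F(1) insert.hyps by (intro exI[of _ "insert F M"]) simp
qed

text \<open>Both claims come from a matching of size \<open>s + 1\<close> that would otherwise exist: through \<open>s + 1\<close>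
  vertices of \<open>T\<close>, or through all \<open>s\<close> vertices of \<open>T\<close> while avoiding \<open>F\<close>, with \<open>F\<close> added
  afterwards. In both cases the greedy choice has to avoid at most \<open>k * (s + 1)\<close> vertices.\<close>

lemma high_degree_structure:
  assumes V: "finite V" "\<F> \<subseteq> nsets V k" "k > 0" and "matching_number \<F> \<le> s"
    and "T \<subseteq> V" and "\<forall>x\<in>T. card {F \<in> \<F>. x \<in> F} > k * (s + 1) * card V ^ (k - 2)"
  shows "card T \<le> s" and "card T = s \<Longrightarrow> F \<in> \<F> \<Longrightarrow> F \<inter> T \<noteq> {}"
proof -
  have fin: "finite \<F>" using V finite_imp_finite_nsets finite_subset by metis
  have finT: "finite T" using V(1) assms(5) finite_subset by blast
  show "card T \<le> s"
  proof (rule ccontr)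
    assume "\<not> card T \<le> s"
    then obtain S where S: "S \<subseteq> T" "card S = s + 1"
      using obtain_subset_with_card_n[of "s + 1" T] by auto
    then have "finite S" using finT finite_subset by blast
    then obtain M where "M \<subseteq> \<F>" "disjoint M" "card M = s + 1"
      using matching_through_high_degree[OF V, of S "{}" "k * (s + 1)"] S assms(6) by auto
    then show False using card_le_matching_number[OF fin, of M] assms(4) by simp
  qed
  assume T: "card T = s" and F: "F \<in> \<F>"
  show "F \<inter> T \<noteq> {}"
  proof
    assume "F \<inter> T = {}"
    moreover have kF: "finite F" "card F = k" using V(2) F by (auto simp: nsets_def)
    ultimately obtain M where M: "M \<subseteq> \<F>" "disjoint M" "card M = s" "finite M" "\<Union>M \<inter> F = {}"
      using matching_through_high_degree[OF V finT, of F "k * (s + 1)"] T assms(6)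
      by (auto simp: Int_commute)
    have "F \<noteq> {}" using kF V(3) by auto
    then have "F \<notin> M" using M(5) by blast
    moreover have "disjoint (insert F M)" using M(2,5) by (auto simp: pairwise_insert disjnt_def)
    ultimately show False
      using card_le_matching_number[OF fin, of "insert F M"] M F assms(4) by simp
  qed
qed

text \<open>The cover \<open>U\<close> is the union of a maximum matching: a member disjoint from it would extend the
  matching.\<close>

lemma matching_cover:
  assumes V: "finite V" "\<F> \<subseteq> nsets V k" "k > 0" and "matching_number \<F> \<le> s"
  obtains U where "finite U" and "card U \<le> k * s" and "\<And>F. F \<in> \<F> \<Longrightarrow> F \<inter> U \<noteq> {}"
proof -
  have fin: "finite \<F>" using V finite_imp_finite_nsets finite_subset by metis
  let ?P = "\<lambda>M. M \<subseteq> \<F> \<and> disjoint M"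
  have "?P {}" by simp
  moreover have "card M < s + 1" if "?P M" for M
    using card_le_matching_number[OF fin, of M] that assms(4) by simp
  ultimately obtain M where M: "?P M" "\<forall>N. ?P N \<longrightarrow> card N \<le> card M"
    using ex_has_greatest_nat[of ?P "{}" card "s + 1"] by blast
  have finM: "finite M" using M(1) fin finite_subset by blast
  have mem: "finite F" "card F = k" if "F \<in> \<F>" for F using that V(2) by (auto simp: nsets_def)
  show thesis
  proof (rule that)
    show "finite (\<Union>M)" using finM mem M(1) by blast
    have "card (\<Union>M) \<le> (\<Sum>F\<in>M. card F)" by (rule card_Union_le_sum_card)
    also have "\<dots> = card M * k" using mem M(1) by (simp add: subset_iff)
    also have "\<dots> \<le> k * s" using card_le_matching_number[OF fin, of M] M(1) assms(4) by simp
    finally show "card (\<Union>M) \<le> k * s" .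
    fix F assume F: "F \<in> \<F>"
    show "F \<inter> \<Union>M \<noteq> {}"
    proof
      assume disj: "F \<inter> \<Union>M = {}"
      have "F \<noteq> {}" using mem[OF F] V(3) by auto
      then have "F \<notin> M" using disj by blast
      moreover have "disjoint (insert F M)"
        using M(1) disj by (auto simp: pairwise_insert disjnt_def)
      ultimately show False using M F finM by (metis Suc_n_not_le_n card_insert_disjoint insert_subset)
    qed
  qed
qed

section \<open>Few vertices of high degree\<close>

text \<open>Let \<open>\<R>\<close> consist of the members that avoid \<open>T\<close>. A set \<open>E\<close> disjoint from \<open>T\<close> has at most \<open>s\<close>
  supersets in \<open>\<F>\<close> obtained by adding a vertex of \<open>T\<close>; all others lie in \<open>\<R>\<close>. The square of its
  degree is thus at most \<open>2 * s\<^sup>2 + 2 * d\<^sup>2\<close>, where \<open>d\<close> is its degree in \<open>\<R>\<close>. Since \<open>d \<le> n\<close>, the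
  sum of \<open>d\<^sup>2\<close> is at most \<open>n\<close> times the sum of \<open>d\<close>, which double counting bounds in terms of
  \<open>card \<R>\<close>.\<close>

lemma co2_le_few_high_degree:
  fixes T :: "nat set"
  assumes "\<F> \<subseteq> nsets {1..n} k" and "k \<ge> 2" and "n > 0" and "T \<subseteq> {1..n}" and "card T \<le> s"
    and rest: "card {F \<in> \<F>. F \<inter> T = {}} \<le> c * n ^ (k - 2)"
  shows "co2 n k \<F> \<le> card {E \<in> nsets {1..n} (k - 1). E \<inter> T \<noteq> {}} * (n - (k - 1))\<^sup>2
      + (2 * s\<^sup>2 + 2 * (k + 1) * c) * n ^ (k - 1)"
proof -
  let ?V = "{1..n}" and ?N = "nsets {1..n} (k - 1)" and ?R = "{F \<in> \<F>. F \<inter> T = {}}"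
  have finN: "finite ?N" by (simp add: finite_imp_finite_nsets)
  have fin: "finite \<F>" using assms(1) finite_imp_finite_nsets finite_subset by blast
  have finT: "finite T" using assms(4) finite_subset by blast
  have k0: "k > 0" using assms(2) by simp
  have Rsub: "?R \<subseteq> nsets ?V k" using assms(1) by auto
  have deg: "set_degree \<F> E \<le> s + set_degree ?R E" if E: "E \<in> ?N" "E \<inter> T = {}" for E
  proof -
    have "{F \<in> \<F>. E \<subseteq> F} \<subseteq> (\<lambda>x. insert x E) ` T \<union> {F \<in> ?R. E \<subseteq> F}"
    proof
      fix F assume F: "F \<in> {F \<in> \<F>. E \<subseteq> F}"
      then have "F \<in> (\<lambda>x. insert x E) ` (?V - E)"
        using nsets_superset_is_insert[OF E(1) _ _ k0] assms(1) by (simp add: subset_iff)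
      then obtain x where "F = insert x E" by (rule imageE)
      then show "F \<in> (\<lambda>x. insert x E) ` T \<union> {F \<in> ?R. E \<subseteq> F}" using F E(2) by auto
    qed
    then have "set_degree \<F> E \<le> card ((\<lambda>x. insert x E) ` T \<union> {F \<in> ?R. E \<subseteq> F})"
      unfolding set_degree_def using fin finT by (intro card_mono) auto
    also have "\<dots> \<le> card ((\<lambda>x. insert x E) ` T) + card {F \<in> ?R. E \<subseteq> F}" by (rule card_Un_le)
    also have "\<dots> \<le> s + set_degree ?R E"
      unfolding set_degree_def
      using order_trans[OF card_image_le[OF finT] assms(5)] by (rule add_right_mono)
    finally show ?thesis .
  qed
  have sq: "(set_degree \<F> E)\<^sup>2 \<le> 2 * s\<^sup>2 + 2 * n * set_degree ?R E" if E: "E \<in> ?N" "E \<inter> T = {}" for E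
  proof -
    let ?d = "set_degree ?R E"
    have "?d \<le> n" using set_degree_le[OF _ Rsub k0 E(1)] by simp
    then have "?d * ?d \<le> n * ?d" by (rule mult_right_mono) simp
    moreover have "(s + ?d)\<^sup>2 \<le> 2 * s\<^sup>2 + 2 * (?d * ?d)"
    proof -
      have "0 \<le> (int s - int ?d)\<^sup>2" by simp
      then have "(int s + int ?d)\<^sup>2 \<le> 2 * (int s)\<^sup>2 + 2 * (int ?d * int ?d)"
        by (simp add: power2_eq_square algebra_simps)
      then have "int ((s + ?d)\<^sup>2) \<le> int (2 * s\<^sup>2 + 2 * (?d * ?d))" by simp
      then show ?thesis by (simp only: of_nat_le_iff)
    qed
    moreover have "(set_degree \<F> E)\<^sup>2 \<le> (s + ?d)\<^sup>2" using deg[OF E] by (intro power_mono) auto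
    ultimately show ?thesis unfolding mult.assoc by linarith
  qed
  have split: "co2 n k \<F> = (\<Sum>E \<in> {E \<in> ?N. E \<inter> T \<noteq> {}}. (set_degree \<F> E)\<^sup>2)
      + (\<Sum>E \<in> {E \<in> ?N. E \<inter> T = {}}. (set_degree \<F> E)\<^sup>2)"
    unfolding co2_def using finN by (subst sum.union_disjoint[symmetric]) (auto intro: sum.cong)
  have "(\<Sum>E \<in> {E \<in> ?N. E \<inter> T \<noteq> {}}. (set_degree \<F> E)\<^sup>2)
      \<le> (\<Sum>E \<in> {E \<in> ?N. E \<inter> T \<noteq> {}}. (n - (k - 1))\<^sup>2)"
    using set_degree_le[OF _ assms(1) k0] by (intro sum_mono power_mono) auto
  also have "\<dots> = card {E \<in> ?N. E \<inter> T \<noteq> {}} * (n - (k - 1))\<^sup>2" by simp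
  finally have meeting: "(\<Sum>E \<in> {E \<in> ?N. E \<inter> T \<noteq> {}}. (set_degree \<F> E)\<^sup>2)
      \<le> card {E \<in> ?N. E \<inter> T \<noteq> {}} * (n - (k - 1))\<^sup>2" .
  have "(\<Sum>E \<in> {E \<in> ?N. E \<inter> T = {}}. (set_degree \<F> E)\<^sup>2)
      \<le> (\<Sum>E \<in> {E \<in> ?N. E \<inter> T = {}}. 2 * s\<^sup>2 + 2 * n * set_degree ?R E)"
    using sq by (intro sum_mono) auto
  also have "\<dots> \<le> (\<Sum>E \<in> ?N. 2 * s\<^sup>2 + 2 * n * set_degree ?R E)"
    using finN by (intro sum_mono2) auto
  also have "\<dots> = 2 * s\<^sup>2 * card ?N + 2 * n * (\<Sum>E \<in> ?N. set_degree ?R E)"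
    by (simp add: sum.distrib sum_distrib_left)
  also have "\<dots> \<le> 2 * s\<^sup>2 * n ^ (k - 1) + 2 * n * ((k + 1) * (c * n ^ (k - 2)))"
  proof (intro add_mono mult_left_mono)
    show "card ?N \<le> n ^ (k - 1)" by (simp add: card_nsets_choose choose_le_power)
    have "(\<Sum>E \<in> ?N. set_degree ?R E) \<le> (k + 1) * card ?R"
      using sum_set_degree[OF _ Rsub] by simp
    also have "\<dots> \<le> (k + 1) * (c * n ^ (k - 2))" using rest by (rule mult_left_mono) simp
    finally show "(\<Sum>E \<in> ?N. set_degree ?R E) \<le> (k + 1) * (c * n ^ (k - 2))" .
  qed auto
  also have "\<dots> = (2 * s\<^sup>2 + 2 * (k + 1) * c) * n ^ (k - 1)"
  proof -
    have "k - 1 = Suc (k - 2)" using assms(2) by simp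
    then have "n ^ (k - 1) = n * n ^ (k - 2)" by simp
    then show ?thesis by (simp add: algebra_simps)
  qed
  finally show ?thesis unfolding split using meeting by (rule add_mono[rotated])
qed

lemma set_degree_meeting_family:
  assumes "E \<in> nsets {1..n} (k - 1)" and "E \<inter> T \<noteq> {}" and "k > 0"
  shows "set_degree (meeting_family n k T) E = n - (k - 1)"
proof -
  have "F \<in> (\<lambda>x. insert x E) ` ({1..n} - E)" if "F \<in> nsets {1..n} k" "E \<subseteq> F" for F
    by (rule nsets_superset_is_insert[OF assms(1) that assms(3)])
  moreover have "insert x E \<in> meeting_family n k T" if "x \<in> {1..n} - E" for x
    using insert_in_nsets[OF assms(1) that assms(3)] assms(2) by (simp add: meeting_family_def)
  ultimately have "{F \<in> meeting_family n k T. E \<subseteq> F} = (\<lambda>x. insert x E) ` ({1..n} - E)"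
    by (auto simp: meeting_family_def)
  then have "set_degree (meeting_family n k T) E = card ((\<lambda>x. insert x E) ` ({1..n} - E))"
    by (simp only: set_degree_def)
  also have "\<dots> = card ({1..n} - E)" by (rule card_insert_image) blast
  also have "\<dots> = n - (k - 1)"
    using assms(1) by (simp add: nsets_def card_Diff_subset)
  finally show ?thesis .
qed

text \<open>The binomial coefficient bounds from below the number of sets \<open>E\<close> that contain \<open>x\<close> and avoid
  \<open>T\<close>. The number of sets \<open>E\<close> meeting \<open>T\<close> is left unevaluated, so that it cancels against the same
  term in the upper bound for \<open>\<F>\<close> and no two leading terms have to be subtracted.\<close>

lemma co2_meeting_family_insert_ge:
  assumes "k \<ge> 2" and "T \<subseteq> {1..n}" and "x \<in> {1..n} - T" and "card T < s"
  shows "co2 n k (meeting_family n k (insert x T)) \<ge>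
    (card {E \<in> nsets {1..n} (k - 1). E \<inter> T \<noteq> {}} + (n - s choose (k - 2))) * (n - (k - 1))\<^sup>2"
proof -
  let ?N = "nsets {1..n} (k - 1)" and ?B = "meeting_family n k (insert x T)"
  let ?A = "{E \<in> ?N. E \<inter> T \<noteq> {}}" and ?A' = "insert x ` nsets ({1..n} - insert x T) (k - 2)"
  have finN: "finite ?N" by (simp add: finite_imp_finite_nsets)
  have finT: "finite T" using assms(2) finite_subset by blast
  have "inj_on (insert x) (nsets ({1..n} - insert x T) (k - 2))"
    by (auto simp: inj_on_def nsets_def)
  then have "card ?A' = (n - Suc (card T)) choose (k - 2)"
    using assms(2,3) finT
    by (simp add: card_image card_nsets_choose card_Diff_subset)
  moreover have "n - s \<le> n - Suc (card T)" using assms(4) by simp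
  ultimately have A'ge: "n - s choose (k - 2) \<le> card ?A'" using binomial_right_mono by metis
  have A'sub: "?A' \<subseteq> {E \<in> ?N. x \<in> E \<and> E \<inter> T = {}}"
  proof -
    have "insert x F \<in> ?N" if F: "F \<in> nsets ({1..n} - insert x T) (k - 2)" for F
    proof -
      have "finite F" "x \<notin> F" "F \<subseteq> {1..n}" "card F = k - 2" using F by (auto simp: nsets_def)
      moreover from this have "card (insert x F) = k - 1" using assms(1) by simp
      ultimately show ?thesis using assms(3) by (simp add: nsets_def)
    qed
    moreover have "insert x F \<inter> T = {}" if "F \<in> nsets ({1..n} - insert x T) (k - 2)" for F
      using that assms(3) unfolding nsets_def by blast
    ultimately show ?thesis by (simp add: image_subset_iff)
  qed
  have "(card ?A + (n - s choose (k - 2))) * (n - (k - 1))\<^sup>2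
      \<le> (card ?A + card ?A') * (n - (k - 1))\<^sup>2"
    using A'ge by (intro mult_right_mono) auto
  also have "card ?A + card ?A' = card (?A \<union> ?A')"
    using A'sub finN finite_subset[OF A'sub] by (intro card_Un_disjoint[symmetric]) auto
  also have "card (?A \<union> ?A') * (n - (k - 1))\<^sup>2 = (\<Sum>E \<in> ?A \<union> ?A'. (set_degree ?B E)\<^sup>2)"
  proof -
    have "set_degree ?B E = n - (k - 1)" if "E \<in> ?A \<union> ?A'" for E
      using that A'sub assms(1) by (intro set_degree_meeting_family) auto
    then show ?thesis by simp
  qed
  also have "\<dots> \<le> co2 n k ?B"
    unfolding co2_def using A'sub finN by (intro sum_mono2) auto
  finally show ?thesis .
qed

text \<open>Both \<open>n - s\<close> and \<open>n - (k - 1)\<close> are at least \<open>n / 2\<close>, so the right-hand side is at least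
  \<open>n ^ k / (2 ^ k * (k - 2) ^ (k - 2))\<close>, one power of \<open>n\<close> more than on the left.\<close>

lemma choose_times_square_gt:
  fixes n s k C :: nat
  assumes "k \<ge> 2" and "n \<ge> 2 * (s + k)" and "n > C * 2 ^ k * (k - 2) ^ (k - 2)"
  shows "C * n ^ (k - 1) < (n - s choose (k - 2)) * (n - (k - 1))\<^sup>2"
proof -
  define m where "m = k - 2"
  have k: "k = m + 2" using assms(1) by (simp add: m_def)
  have pos: "n > 0" using assms(2) k by simp
  have "(2 ^ k * m ^ m) * (C * n ^ (k - 1)) = (C * 2 ^ k * m ^ m) * n ^ (m + 1)"
    using k by simp
  also have "\<dots> < n * n ^ (m + 1)"
    using assms(3) pos by (intro mult_strict_right_mono) (auto simp: m_def)
  also have "\<dots> = n ^ m * n\<^sup>2" by (simp add: power2_eq_square)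
  also have "\<dots> \<le> (2 * (n - s)) ^ m * (2 * (n - (k - 1)))\<^sup>2"
    using assms(2) k by (intro mult_mono power_mono) auto
  also have "\<dots> = 2 ^ k * ((n - s) ^ m * (n - (k - 1))\<^sup>2)"
    using k by (simp add: power_mult_distrib power_add)
  also have "\<dots> \<le> 2 ^ k * ((m ^ m * (n - s choose m)) * (n - (k - 1))\<^sup>2)"
    using assms(2) k by (intro mult_left_mono mult_right_mono power_le_choose) auto
  also have "\<dots> = (2 ^ k * m ^ m) * ((n - s choose (k - 2)) * (n - (k - 1))\<^sup>2)"
    by (simp add: m_def)
  finally show ?thesis unfolding mult_less_cancel1 by (rule conjunct2)
qed

text \<open>The members avoiding \<open>T\<close> meet a cover of at most \<open>k * s\<close> vertices, and they meet it in a vertex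
  outside \<open>T\<close>, whose degree is at most \<open>L * n ^ (k - 2)\<close>. So there are at most
  \<open>k * s * L * n ^ (k - 2)\<close> of them, and their effect is outweighed by the gain from adding one
  more vertex \<open>x\<close> to \<open>T\<close>.\<close>

lemma few_high_degree_not_extremal:
  assumes F: "\<F> \<subseteq> nsets {1..n} k" "matching_number \<F> \<le> s" and "k \<ge> 2"
    and T: "T = {x \<in> {1..n}. card {F \<in> \<F>. x \<in> F} > L * n ^ (k - 2)}" "card T < s"
    and n: "n \<ge> 2 * (s + k)"
      "n > (2 * s\<^sup>2 + 2 * (k + 1) * (k * s * L)) * 2 ^ k * (k - 2) ^ (k - 2)"
  shows "co2 n k \<F> < co2 n k (hitting_family n k s)"
proof -
  have Tn: "T \<subseteq> {1..n}" using T(1) by auto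
  have fin: "finite \<F>" using F(1) finite_imp_finite_nsets finite_subset by blast
  let ?R = "{F \<in> \<F>. F \<inter> T = {}}" and ?C = "2 * s\<^sup>2 + 2 * (k + 1) * (k * s * L)"
  have k0: "k > 0" using assms(3) by simp
  obtain U where U: "finite U" "card U \<le> k * s" "\<And>F. F \<in> \<F> \<Longrightarrow> F \<inter> U \<noteq> {}"
    using matching_cover[OF _ F(1) k0 F(2)] by auto
  have "?R \<subseteq> (\<Union>y \<in> U \<inter> {1..n} - T. {F \<in> \<F>. y \<in> F})"
  proof
    fix F assume "F \<in> ?R"
    then show "F \<in> (\<Union>y \<in> U \<inter> {1..n} - T. {F \<in> \<F>. y \<in> F})"
      using U(3)[of F] F(1) by (fastforce simp: nsets_def)
  qed
  then have "card ?R \<le> card (\<Union>y \<in> U \<inter> {1..n} - T. {F \<in> \<F>. y \<in> F})"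
    using fin by (intro card_mono) auto
  also have "\<dots> \<le> (\<Sum>y \<in> U \<inter> {1..n} - T. card {F \<in> \<F>. y \<in> F})"
    by (rule card_UN_le) auto
  also have "\<dots> \<le> (\<Sum>y \<in> U \<inter> {1..n} - T. L * n ^ (k - 2))"
    by (rule sum_mono) (auto simp: T(1) not_less)
  also have "\<dots> \<le> (k * s) * (L * n ^ (k - 2))"
  proof -
    have "card (U \<inter> {1..n} - T) \<le> card U" using U(1) by (intro card_mono) auto
    then show ?thesis using U(2) by (simp only: sum_constant) (intro mult_right_mono, auto)
  qed
  finally have R: "card ?R \<le> (k * s * L) * n ^ (k - 2)" by (simp add: mult.assoc)
  have "card T < card {1..n}" using T(2) n(1) by simp
  then obtain x where x: "x \<in> {1..n} - T"
    using Tn by (metis Diff_eq_empty_iff ex_in_conv nat_neq_iff subset_antisym)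
  let ?A = "{E \<in> nsets {1..n} (k - 1). E \<inter> T \<noteq> {}}"
  have "co2 n k \<F> \<le> card ?A * (n - (k - 1))\<^sup>2 + ?C * n ^ (k - 1)"
    using R T(2) Tn n(1) assms(3) by (intro co2_le_few_high_degree[OF F(1)]) auto
  also have "\<dots> < card ?A * (n - (k - 1))\<^sup>2 + (n - s choose (k - 2)) * (n - (k - 1))\<^sup>2"
    using choose_times_square_gt[OF assms(3) n] by simp
  also have "\<dots> \<le> co2 n k (meeting_family n k (insert x T))"
    using co2_meeting_family_insert_ge[OF assms(3) Tn x T(2)] by (simp add: add_mult_distrib)
  also have "\<dots> \<le> co2 n k (hitting_family n k s)"
  proof -
    have "card (insert x T) \<le> s" using T(2) finite_subset[OF Tn] by (simp add: card_insert_if)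
    moreover have "insert x T \<subseteq> {1..n}" "s \<le> n" using x Tn n(1) by auto
    ultimately show ?thesis using meeting_family_extremal[OF subset_refl] by blast
  qed
  finally show ?thesis .
qed

section \<open>The extremal theorem\<close>

lemma singletons_subset_meeting_family:
  assumes "\<F> \<subseteq> nsets {1..n} 1" and "matching_number \<F> \<le> s"
  shows "\<F> \<subseteq> meeting_family n 1 (\<Union>\<F>)" and "card (\<Union>\<F>) \<le> s"
proof -
  have single: "\<exists>x. F = {x}" if "F \<in> \<F>" for F
    using that assms(1) by (auto simp: nsets_def card_1_singleton_iff)
  show "\<F> \<subseteq> meeting_family n 1 (\<Union>\<F>)"
    using assms(1) single unfolding meeting_family_def by blast
  have fin: "finite \<F>" using assms(1) finite_imp_finite_nsets finite_subset by blast
  have "disjoint \<F>" using single by (fastforce simp: pairwise_def disjnt_def)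
  then have "card \<F> \<le> s" using card_le_matching_number[OF fin, of \<F>] assms(2) by simp
  moreover have "card (\<Union>\<F>) \<le> (\<Sum>F\<in>\<F>. card F)" by (rule card_Union_le_sum_card)
  moreover have "(\<Sum>F\<in>\<F>. card F) = card \<F>" using assms(1) by (simp add: nsets_def subset_iff)
  ultimately show "card (\<Union>\<F>) \<le> s" by simp
qed

theorem theorem1p4:
  fixes k s :: nat
  assumes "k > 0" and "s > 0"
  shows "\<exists>n0::nat. \<forall>n\<ge>n0. \<forall>\<F>. \<F> \<subseteq> nsets {1..n} k \<and> matching_number \<F> \<le> s \<longrightarrow>
           co2 n k \<F> \<le> co2 n k (hitting_family n k s) \<and>
           (co2 n k \<F> = co2 n k (hitting_family n k s) \<longleftrightarrow>
              family_iso n \<F> (hitting_family n k s))"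
proof -
  define L where "L = k * (s + 1)"
  \<comment> \<open>The first summand makes \<open>n - s\<close> and \<open>n - (k - 1)\<close> at least \<open>n / 2\<close>; the second exceeds the
    constant of the lower-order terms by the factor that the binomial estimate loses.\<close>
  define n0 where "n0 = 2 * (s + k)
    + Suc ((2 * s\<^sup>2 + 2 * (k + 1) * (k * s * L)) * 2 ^ k * (k - 2) ^ (k - 2))"
  show ?thesis
  proof (intro exI[of _ n0] allI impI)
    fix n \<F>
    assume "n \<ge> n0" and F: "\<F> \<subseteq> nsets {1..n} k \<and> matching_number \<F> \<le> s"
    then have n: "n \<ge> 2 * (s + k)"
      "n > (2 * s\<^sup>2 + 2 * (k + 1) * (k * s * L)) * 2 ^ k * (k - 2) ^ (k - 2)"
      unfolding n0_def by linarith+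
    have sn: "s \<le> n" using n(1) by simp
    show "co2 n k \<F> \<le> co2 n k (hitting_family n k s) \<and>
           (co2 n k \<F> = co2 n k (hitting_family n k s) \<longleftrightarrow>
              family_iso n \<F> (hitting_family n k s))"
    proof (cases "k = 1")
      case True
      then have "\<Union>\<F> \<subseteq> {1..n}" using F by (auto simp: nsets_def)
      then show ?thesis
        using singletons_subset_meeting_family[of \<F> n s] F True sn
        by (intro meeting_family_extremal[of _ _ _ "\<Union>\<F>"]) auto
    next
      case False
      then have k2: "k \<ge> 2" using assms(1) by simp
      define T where "T = {x \<in> {1..n}. card {F \<in> \<F>. x \<in> F} > L * n ^ (k - 2)}"
      have Tn: "T \<subseteq> {1..n}" by (auto simp: T_def)
      have high: "\<forall>x\<in>T. card {F \<in> \<F>. x \<in> F} > k * (s + 1) * card {1..n} ^ (k - 2)"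
        by (simp add: T_def L_def)
      note high_deg = high_degree_structure[OF _ _ assms(1) _ Tn high]
      show ?thesis
      proof (cases "card T = s")
        case True
        then have "\<F> \<subseteq> meeting_family n k T"
          using high_deg(2) F unfolding meeting_family_def by auto
        then show ?thesis using meeting_family_extremal Tn True sn by blast
      next
        case False
        then have "card T < s" using high_deg(1) F by fastforce
        then have "co2 n k \<F> < co2 n k (hitting_family n k s)"
          using few_high_degree_not_extremal[OF _ _ k2 T_def _ n] F by blast
        then show ?thesis using co2_family_iso by fastforce
      qed
    qed
  qed
qed

end
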